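(* Let $\Lambda$ be an $n$-dimensional lattice. Assume $m=p_1^{r_1}\cdots p_l^{r_l}$ with $p_1,\dots,p_l$ distinct primes, and $d_i=p_1^{\alpha_{1i}}\cdots p_l^{\alpha_{li}}$ for $1\le i\le n$, where $\alpha_k=(\alpha_{k1},\dots,\alpha_{kn})\in\mathcal P(n,r_k)$ for all $1\le k\le l$. Then there is a bijection $$\mathcal S(d_1,\dots,d_n)\simeq\mathcal S_{\alpha_1}(p_1)\times\cdots\times\mathcal S_{\alpha_l}(p_l),$$ where the $p_k^{\alpha_{ki}}$ are the elementary factors of the sublattices in $\mathcal S(d_1,\dots,d_n)$. Moreover, $$f(d_1,\dots,d_n)=f_{\alpha_1}(p_1)\cdots f_{\alpha_l}(p_l).$$
   Context: An $n$-dimensional lattice is the $\mathbb{Z}$-span of $n$ linearly independent vectors in a Euclidean space; a sublattice of $\Lambda$ is a subset of $\Lambda$ which is itself an $n$-dimensional lattice. A coefficient matrix of a sublattice $\Lambda^*$ is the integer matrix whose rows are the coordinates, in a basis of $\Lambda$, of the vectors of a basis of $\Lambda^*$. The invariant factors of $\Lambda^*$ are the diagonal entries $d_1\mid d_2\mid\cdots\mid d_n$ (positive integers) of the Smith normal form of a coefficient matrix; they do not depend on the choices of bases, and $\Lambda/\Lambda^*\cong\prod_i\mathbb{Z}/d_i\mathbb{Z}$. The elementary factors of $\Lambda^*$ are the prime powers in the prime factorizations of its invariant factors. Two sublattices $\Lambda^*,\Lambda^\bullet$ of $\Lambda$ are unimodular equivalent if there is a linear transformation $\sigma$ with $\sigma(\Lambda)=\Lambda$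 and $\sigma(\Lambda^* )=\Lambda^\bullet$; this holds if and only if their invariant factors coincide. For positive integers $d_1\mid\cdots\mid d_n$, $\mathcal S(d_1,\dots,d_n)$ is the unimodular equivalence class of all sublattices of $\Lambda$ with invariant factors $d_1,\dots,d_n$, and $f(d_1,\dots,d_n)$ is its cardinality. $\mathcal P(n,k)=\{(\alpha_1,\dots,\alpha_n)\in\mathbb{Z}^n : 0\le\alpha_1\le\cdots\le\alpha_n,\ \sum_{i=1}^n\alpha_i=k\}$. For a prime $p$ and $\alpha=(\alpha_1,\dots,\alpha_n)\in\mathcal P(n,k)$, $\mathcal S_\alpha(p)=\mathcal S(p^{\alpha_1},\dots,p^{\alpha_n})$ and $f_\alpha(p)=f(p^{\alpha_1},\dots,p^{\alpha_n})$. *)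

theory Defs
  imports
    "HOL-Analysis.Euclidean_Space"
    "HOL-Computational_Algebra.Primes"
    "Jordan_Normal_Form.Matrix"
begin

text \<open>
  Tuples \<open>(x\<^sub>1, \<dots>, x\<^sub>n)\<close>, and ordered bases, are lists of length \<open>n\<close>, indexed from 0.
\<close>

definition int_span :: "'a::real_vector list \<Rightarrow> 'a set" where
  "int_span bs = range (\<lambda>z :: nat \<Rightarrow> int. \<Sum>i<length bs. of_int (z i) *\<^sub>R bs ! i)"

definition lattice_basis :: "'a::euclidean_space list \<Rightarrow> 'a set \<Rightarrow> bool" where
  "lattice_basis bs L \<longleftrightarrow> distinct bs \<and> independent (set bs) \<and> L = int_span bs"

definition is_lattice :: "nat \<Rightarrow> 'a::euclidean_space set \<Rightarrow> bool" where
  "is_lattice n L \<longleftrightarrow> (\<exists>bs. length bs = n \<and> lattice_basis bs L)"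

definition sublattice :: "'a::euclidean_space set \<Rightarrow> 'a set \<Rightarrow> bool" where
  "sublattice L M \<longleftrightarrow> M \<subseteq> L \<and> (\<exists>n. is_lattice n L \<and> is_lattice n M)"

definition coefficient_matrix :: "'a::euclidean_space set \<Rightarrow> 'a set \<Rightarrow> int mat \<Rightarrow> bool" where
  "coefficient_matrix L M A \<longleftrightarrow>
     (\<exists>bs cs. lattice_basis bs L \<and> lattice_basis cs M \<and>
        A \<in> carrier_mat (length cs) (length bs) \<and>
        (\<forall>i<length cs. cs ! i = (\<Sum>j<length bs. of_int (A $$ (i, j)) *\<^sub>R bs ! j)))"

text \<open>
  Only nonsingular square matrices are needed, so all diagonal entries are required to be
  positive. Invertibility is over the integers.
\<close>

definition smith_normal_form :: "int mat \<Rightarrow> nat list \<Rightarrow> bool" where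
  "smith_normal_form A ds \<longleftrightarrow>
     (\<forall>d\<in>set ds. 0 < d) \<and>
     (\<forall>i. Suc i < length ds \<longrightarrow> ds ! i dvd ds ! Suc i) \<and>
     A \<in> carrier_mat (length ds) (length ds) \<and>
     (\<exists>P \<in> carrier_mat (length ds) (length ds). \<exists>Q \<in> carrier_mat (length ds) (length ds).
        invertible_mat P \<and> invertible_mat Q \<and>
        P * A * Q = mat_diag (length ds) (\<lambda>i. int (ds ! i)))"

text \<open>
  The description is well defined for a sublattice \<open>M\<close> of \<open>L\<close>: the Smith normal form
  exists, is unique, and does not depend on the coefficient matrix.
\<close>

definition invariant_factors :: "'a::euclidean_space set \<Rightarrow> 'a set \<Rightarrow> nat list" where
  "invariant_factors L M =
     (THE ds. \<exists>A. coefficient_matrix L M A \<and> smith_normal_form A ds)"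

text \<open>Elementary factors are counted with multiplicity; trivial powers \<open>p ^ 0\<close> do not occur.\<close>

definition elementary_factors :: "'a::euclidean_space set \<Rightarrow> 'a set \<Rightarrow> nat multiset" where
  "elementary_factors L M =
     (\<Sum>d\<leftarrow>invariant_factors L M. {# p ^ multiplicity p d. p \<in># mset_set (prime_factors d) #})"

definition sublattice_class :: "'a::euclidean_space set \<Rightarrow> nat list \<Rightarrow> 'a set set" where
  "sublattice_class L ds = {M. sublattice L M \<and> invariant_factors L M = ds}"

text \<open>
  A lattice has only finitely many sublattices of a given index, so the cardinality below
  is never the default value of an infinite set.
\<close>

definition class_card :: "'a::euclidean_space set \<Rightarrow> nat list \<Rightarrow> nat" where
  "class_card L ds = card (sublattice_class L ds)"

definition exponent_tuples :: "nat \<Rightarrow> nat \<Rightarrow> nat list set" where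
  "exponent_tuples n k = {\<alpha>. length \<alpha> = n \<and> sorted \<alpha> \<and> sum_list \<alpha> = k}"

definition primary_class :: "'a::euclidean_space set \<Rightarrow> nat \<Rightarrow> nat list \<Rightarrow> 'a set set" where
  "primary_class L p \<alpha> = sublattice_class L (map (\<lambda>a. p ^ a) \<alpha>)"

definition primary_class_card :: "'a::euclidean_space set \<Rightarrow> nat \<Rightarrow> nat list \<Rightarrow> nat" where
  "primary_class_card L p \<alpha> = class_card L (map (\<lambda>a. p ^ a) \<alpha>)"

end

theory Submission
  imports Defs "Jordan_Normal_Form.Determinant"
begin

text \<open>
  Let \<open>q\<^sub>1, \<dots>, q\<^sub>l\<close> be the pairwise coprime prime powers \<open>p\<^sub>k\<close> to the \<open>r\<^sub>k\<close>. The bijection is the primary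
  decomposition: it sends a sublattice \<open>M\<close> of \<open>L\<close> to the tuple of the larger sublattices
  \<open>M + q\<^sub>k L\<close>, and its inverse sends a tuple of sublattices to their intersection.

  Everything is read off from stacked bases (lemma \<open>stacked_basis_exists\<close>): a sublattice \<open>M\<close> of
  full rank admits a basis \<open>b\<^sub>1, \<dots>, b\<^sub>n\<close> of \<open>L\<close> and positive integers forming a divisibility chain
  \<open>d\<^sub>1, \<dots>, d\<^sub>n\<close> such that the vectors \<open>d\<^sub>i b\<^sub>i\<close> form a basis of \<open>M\<close>. The \<open>d\<^sub>i\<close> are determined by
  \<open>M\<close> (lemma \<open>stacked_basis_unique\<close>), and a stacked basis is the basis-free form of a Smith normal
  form of a coefficient matrix (lemma \<open>smith_normal_form_iff_stacked_basis\<close>), so the \<open>d\<^sub>i\<close> are the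
  invariant factors. In the coordinates of a stacked basis, membership in \<open>M\<close> means that \<open>d\<^sub>i\<close>
  divides the \<open>i\<close>-th coordinate. Hence the same basis is stacked for \<open>M + q L\<close>, with factors
  \<open>gcd d\<^sub>i q\<close>, and the statement about sublattices turns into arithmetic of coprime integers, one
  coordinate at a time.

  The only point where different bases meet is an arbitrary tuple of sublattices \<open>X\<^sub>k\<close> with
  prescribed factors. Their intersection contains \<open>q\<^sub>1 \<cdots> q\<^sub>l L\<close>, hence has full rank and a
  stacked basis of its own. A Bezout argument recovers \<open>X\<^sub>k\<close> as the intersection plus \<open>q\<^sub>k L\<close>, and
  uniqueness of the invariant factors of \<open>X\<^sub>k\<close> determines those of the intersection.

  The formula for the cardinalities follows from the bijection, and the statement about
  elementary factors from unique factorization of the entries of \<open>d\<close>.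
\<close>

section \<open>Integral spans and lattice bases\<close>

definition int_submodule :: "'a::real_vector set \<Rightarrow> bool" where
  "int_submodule S \<longleftrightarrow> 0 \<in> S \<and> (\<forall>x\<in>S. \<forall>y\<in>S. x - y \<in> S)"

lemma int_submodule_0: "int_submodule S \<Longrightarrow> 0 \<in> S"
  by (simp add: int_submodule_def)

lemma int_submodule_diff: "int_submodule S \<Longrightarrow> x \<in> S \<Longrightarrow> y \<in> S \<Longrightarrow> x - y \<in> S"
  by (simp add: int_submodule_def)

lemma int_submodule_add:
  assumes "int_submodule S" "x \<in> S" "y \<in> S"
  shows "x + y \<in> S"
proof -
  have "x - (0 - y) \<in> S"
    using assms by (intro int_submodule_diff int_submodule_0)
  then show ?thesis by simp
qed

lemma int_submodule_scale:
  assumes S: "int_submodule S" and x: "x \<in> S"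
  shows "of_int z *\<^sub>R x \<in> S"
proof (induction z rule: int_induct[where k = 0])
  case base
  show ?case using S by (simp add: int_submodule_0)
next
  case (step1 i)
  show ?case using int_submodule_add[OF S step1(2) x] by (simp add: scaleR_left_distrib)
next
  case (step2 i)
  show ?case using int_submodule_diff[OF S step2(2) x] by (simp add: scaleR_left_diff_distrib)
qed

lemma int_submodule_scale_nat:
  "int_submodule S \<Longrightarrow> x \<in> S \<Longrightarrow> of_nat k *\<^sub>R x \<in> S"
  using int_submodule_scale[of S x "int k"] by simp

lemma int_submodule_sum:
  assumes "int_submodule S" "\<And>i. i \<in> I \<Longrightarrow> f i \<in> S"
  shows "sum f I \<in> S"
  using assms(2)
  by (induction I rule: infinite_finite_induct)
    (auto intro: int_submodule_add int_submodule_0 assms(1))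

lemma int_span_submodule: "int_submodule (int_span bs)"
  unfolding int_submodule_def
proof (intro conjI ballI)
  show "0 \<in> int_span bs"
    unfolding int_span_def by (rule range_eqI[of _ _ "\<lambda>_. 0"]) simp
next
  fix x y assume "x \<in> int_span bs" "y \<in> int_span bs"
  then obtain u v where "x = (\<Sum>i<length bs. of_int (u i) *\<^sub>R bs ! i)"
    "y = (\<Sum>i<length bs. of_int (v i) *\<^sub>R bs ! i)"
    unfolding int_span_def by auto
  then show "x - y \<in> int_span bs"
    unfolding int_span_def
    by (intro range_eqI[of _ _ "\<lambda>i. u i - v i"])
      (simp add: sum_subtractf scaleR_left_diff_distrib)
qed

lemma int_span_base: "set bs \<subseteq> int_span bs"
proof
  fix x assume "x \<in> set bs"
  then obtain k where k: "k < length bs" "x = bs ! k" by (auto simp: in_set_conv_nth)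
  have "x = (\<Sum>i<length bs. of_int (if i = k then 1 else 0) *\<^sub>R bs ! i)"
    using k by (subst sum.remove[of _ k]) (auto intro!: sum.neutral)
  then show "x \<in> int_span bs" unfolding int_span_def by (intro range_eqI)
qed

lemma int_span_nth: "i < length bs \<Longrightarrow> bs ! i \<in> int_span bs"
  using int_span_base[of bs] by auto

lemma int_span_least:
  assumes "int_submodule S" "set bs \<subseteq> S"
  shows "int_span bs \<subseteq> S"
  unfolding int_span_def
proof clarify
  fix z :: "nat \<Rightarrow> int"
  show "(\<Sum>i<length bs. of_int (z i) *\<^sub>R bs ! i) \<in> S"
    using assms(2)
    by (intro int_submodule_sum[OF assms(1)] int_submodule_scale[OF assms(1)]) auto
qed

lemma int_span_subset_iff: "int_span as \<subseteq> int_span bs \<longleftrightarrow> set as \<subseteq> int_span bs"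
  using int_span_base int_span_least int_span_submodule by blast

lemma int_span_cong_set: "set as = set bs \<Longrightarrow> int_span as = int_span bs"
  using int_span_base[of as] int_span_base[of bs] int_span_subset_iff by blast

lemma int_span_Cons_iff:
  "x \<in> int_span (b # bs) \<longleftrightarrow> (\<exists>c. \<exists>y\<in>int_span bs. x = of_int c *\<^sub>R b + y)"
proof
  assume "x \<in> int_span (b # bs)"
  then obtain z where "x = (\<Sum>i<Suc (length bs). of_int (z i) *\<^sub>R (b # bs) ! i)"
    unfolding int_span_def by auto
  then have "x = of_int (z 0) *\<^sub>R b + (\<Sum>i<length bs. of_int (z (Suc i)) *\<^sub>R bs ! i)"
    unfolding sum.lessThan_Suc_shift by simp
  moreover have "(\<Sum>i<length bs. of_int (z (Suc i)) *\<^sub>R bs ! i) \<in> int_span bs"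
    unfolding int_span_def by (intro range_eqI[of _ _ "\<lambda>i. z (Suc i)"]) simp
  ultimately show "\<exists>c. \<exists>y\<in>int_span bs. x = of_int c *\<^sub>R b + y" by blast
next
  assume "\<exists>c. \<exists>y\<in>int_span bs. x = of_int c *\<^sub>R b + y"
  moreover have "int_span bs \<subseteq> int_span (b # bs)" "b \<in> int_span (b # bs)"
    using int_span_base[of "b # bs"] by (auto simp: int_span_subset_iff)
  ultimately show "x \<in> int_span (b # bs)"
    by (auto intro!: int_submodule_add[OF int_span_submodule]
        int_submodule_scale[OF int_span_submodule])
qed

lemma int_span_Cons_cong: "int_span as = int_span bs \<Longrightarrow> int_span (b # as) = int_span (b # bs)"
  by (auto simp: int_span_Cons_iff)

lemma span_int_span: "span (int_span bs) = span (set bs)"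
proof (rule antisym)
  have "int_span bs \<subseteq> span (set bs)"
    unfolding int_span_def by (auto intro!: span_sum span_scale span_base[OF nth_mem])
  then show "span (int_span bs) \<subseteq> span (set bs)"
    by (simp add: span_minimal)
qed (intro span_mono int_span_base)

text \<open>
  Linear independence and distinctness come for free from the right number of generators. This
  reduces every later change of basis to an equality of integral spans.
\<close>
lemma lattice_basis_iff_dim:
  "lattice_basis bs L \<longleftrightarrow> L = int_span bs \<and> length bs = dim L"
proof
  assume "lattice_basis bs L"
  then have "distinct bs" "independent (set bs)" "L = int_span bs"
    unfolding lattice_basis_def by auto
  then have "dim L = card (set bs)"
    by (metis dim_span dim_span_eq_card_independent span_int_span)
  then show "L = int_span bs \<and> length bs = dim L"
    using \<open>distinct bs\<close> \<open>L = int_span bs\<close> by (simp add: distinct_card)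
next
  assume *: "L = int_span bs \<and> length bs = dim L"
  have d: "dim L = dim (set bs)" using * by (metis dim_span span_int_span)
  then have "length bs \<le> card (set bs)"
    using * by (metis List.finite_set dim_le_card span_superset)
  then have "distinct bs" using card_distinct card_length le_antisym by metis
  moreover have "independent (set bs)"
    by (rule card_le_dim_spanning[of _ "set bs"])
      (use d * \<open>distinct bs\<close> in \<open>auto simp: span_superset distinct_card span_base\<close>)
  ultimately show "lattice_basis bs L" using * by (simp add: lattice_basis_def)
qed

text \<open>
  A list without repetitions enumerates its set, so that a relation between the list entries is
  one between the elements of an independent set.
\<close>
lemma lattice_basis_coeffs_unique:
  assumes "lattice_basis bs L"
    and "(\<Sum>i<length bs. of_int (u i) *\<^sub>R bs ! i) = (\<Sum>i<length bs. of_int (v i) *\<^sub>R bs ! i)"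
    and "i < length bs"
  shows "u i = v i"
proof -
  have d: "distinct bs" and ind: "independent (set bs)"
    using assms(1) by (auto simp: lattice_basis_def)
  have bij: "bij_betw (nth bs) {..<length bs} (set bs)"
    using d by (simp add: bij_betw_nth)
  define w where "w x = real_of_int (u (inv_into {..<length bs} (nth bs) x)
    - v (inv_into {..<length bs} (nth bs) x))" for x
  have w: "w (bs ! j) = of_int (u j - v j)" if "j < length bs" for j
    using bij that by (simp add: w_def bij_betw_def)
  have "(\<Sum>x\<in>set bs. w x *\<^sub>R x) = (\<Sum>j<length bs. w (bs ! j) *\<^sub>R bs ! j)"
    using sum.reindex_bij_betw[OF bij, of "\<lambda>x. w x *\<^sub>R x"] by simp
  also have "\<dots> = 0"
    using assms(2) by (simp add: w scaleR_left_diff_distrib sum_subtractf)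
  finally have "w (bs ! i) = 0"
    using ind assms(3) by (metis List.finite_set independentD nth_mem order_refl)
  then show ?thesis using w[OF assms(3)] by simp
qed

lemma lattice_basis_mem_iff:
  "lattice_basis bs L \<Longrightarrow> x \<in> L \<longleftrightarrow> (\<exists>z. x = (\<Sum>i<length bs. of_int (z i) *\<^sub>R bs ! i))"
  unfolding lattice_basis_def int_span_def by auto

lemma is_lattice_dim: "is_lattice n L \<Longrightarrow> n = dim L"
  unfolding is_lattice_def lattice_basis_iff_dim by auto

definition scaled :: "nat list \<Rightarrow> 'a::real_vector list \<Rightarrow> 'a list" where
  "scaled ds bs = map2 (\<lambda>d b. of_nat d *\<^sub>R b) ds bs"

lemma length_scaled [simp]: "length (scaled ds bs) = min (length ds) (length bs)"
  by (simp add: scaled_def)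

lemma nth_scaled [simp]:
  "i < length ds \<Longrightarrow> i < length bs \<Longrightarrow> scaled ds bs ! i = of_nat (ds ! i) *\<^sub>R bs ! i"
  by (simp add: scaled_def)

lemma scaled_Cons [simp]: "scaled (d # ds) (b # bs) = (of_nat d *\<^sub>R b) # scaled ds bs"
  by (simp add: scaled_def)

lemma int_span_pivot_add:
  assumes "w \<in> int_span cs"
  shows "int_span ((b + w) # cs) = int_span (b # cs)"
proof (rule antisym)
  have "b + w \<in> int_span (b # cs)"
    using assms int_span_Cons_iff[of "b + w" b cs] by (metis of_int_1 scaleR_one)
  then show "int_span ((b + w) # cs) \<subseteq> int_span (b # cs)"
    using int_span_base[of "b # cs"] by (auto simp: int_span_subset_iff)
next
  have "b = of_int 1 *\<^sub>R (b + w) + - w" "- w \<in> int_span cs"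
    using assms int_submodule_scale[OF int_span_submodule, of w cs "-1"] by auto
  then have "b \<in> int_span ((b + w) # cs)"
    using int_span_Cons_iff[of b "b + w" cs] by blast
  then show "int_span (b # cs) \<subseteq> int_span ((b + w) # cs)"
    using int_span_base[of "(b + w) # cs"] by (auto simp: int_span_subset_iff)
qed

text \<open>
  The entry at position \<open>i\<close> becomes the new pivot and the old pivot takes its place: the list is
  only permuted.
\<close>
lemma int_span_exchange:
  assumes "i < length cs"
  shows "int_span (cs ! i # cs[i := b]) = int_span (b # cs)"
proof (rule int_span_cong_set)
  have "set cs = insert (cs ! i) (set (take i cs) \<union> set (drop (Suc i) cs))"
    by (subst id_take_nth_drop[OF assms]) auto
  then show "set (cs ! i # cs[i := b]) = set (b # cs)"
    using assms by (auto simp: upd_conv_take_nth_drop)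
qed

text \<open>
  Among all generating lists of the given length and all elements of \<open>M\<close>, let \<open>d\<close> be the least
  positive leading coefficient that occurs. Whenever some coefficient fails to be a multiple of
  \<open>d\<close>, its remainder modulo \<open>d\<close> can be made a leading coefficient, against minimality. This
  forces a multiple of a generator \<open>b\<close> into \<open>M\<close> (so that \<open>M\<close> splits off \<open>d b\<close>), and it makes
  \<open>d\<close> divide all factors that are split off later. The latter is needed for generating lists \<open>as\<close>
  of the complement other than \<open>cs\<close>, because the induction replaces \<open>cs\<close>.
\<close>
lemma minimal_pivot:
  assumes M: "int_submodule M" "M \<subseteq> int_span bs" "M \<noteq> {0}"
  obtains d b cs where "length bs = Suc (length cs)" "int_span (b # cs) = int_span bs"
    "of_nat d *\<^sub>R b \<in> M"
    "\<And>c y. y \<in> int_span cs \<Longrightarrow> of_int c *\<^sub>R b + y \<in> M \<Longrightarrow> int d dvd c"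
    "\<And>e as i. int_span as = int_span cs \<Longrightarrow> length as = length cs \<Longrightarrow> i < length as \<Longrightarrow>
      of_nat e *\<^sub>R as ! i \<in> M \<Longrightarrow> d dvd e"
proof -
  define P where "P c \<longleftrightarrow> c > 0 \<and> (\<exists>b cs y. length bs = Suc (length cs) \<and>
    int_span (b # cs) = int_span bs \<and> y \<in> int_span cs \<and> of_nat c *\<^sub>R b + y \<in> M)" for c :: nat
  obtain x where x: "x \<in> M" "x \<noteq> 0" using M int_submodule_0 by blast
  then obtain z where z: "x = (\<Sum>j<length bs. of_int (z j) *\<^sub>R bs ! j)"
    using M(2) unfolding int_span_def by auto
  with x obtain i where i: "i < length bs" "z i \<noteq> 0"
    by (metis (mono_tags, lifting) lessThan_iff of_int_0 scaleR_zero_left sum.neutral)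
  \<comment> \<open>A nonzero element has a nonzero coefficient, which becomes positive and leading after a
    change of sign and a permutation.\<close>
  have "P (nat \<bar>z i\<bar>)"
  proof -
    let ?cs = "take i bs @ drop (Suc i) bs"
    let ?y = "\<Sum>j\<in>{..<length bs} - {i}. of_int (sgn (z i) * z j) *\<^sub>R bs ! j"
    have "bs ! j \<in> set ?cs" if "j < length bs" "j \<noteq> i" for j
    proof (cases "j < i")
      case True
      then have "take i bs ! j = bs ! j" "j < length (take i bs)" using that by auto
      then show ?thesis by (metis UnI1 nth_mem set_append)
    next
      case False
      then have "drop (Suc i) bs ! (j - Suc i) = bs ! j" "j - Suc i < length (drop (Suc i) bs)"
        using that by auto
      then show ?thesis by (metis UnI2 nth_mem set_append)
    qed
    then have "?y \<in> int_span ?cs"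
      using int_span_base[of ?cs]
      by (intro int_submodule_sum int_submodule_scale int_span_submodule) auto
    moreover have "set (bs ! i # ?cs) = set bs"
      by (subst (4) id_take_nth_drop[OF i(1)]) auto
    then have "int_span (bs ! i # ?cs) = int_span bs" by (rule int_span_cong_set)
    moreover have "real (nat \<bar>z i\<bar>) = of_int (sgn (z i)) * of_int (z i)"
      by (simp add: sgn_if abs_if)
    then have "of_int (sgn (z i)) *\<^sub>R x = of_nat (nat \<bar>z i\<bar>) *\<^sub>R bs ! i + ?y"
      unfolding z using i(1)
      by (subst sum.remove[of _ i]) (auto simp: scaleR_right_distrib scaleR_sum_right)
    then have "of_nat (nat \<bar>z i\<bar>) *\<^sub>R bs ! i + ?y \<in> M"
      using int_submodule_scale[OF M(1) x(1), of "sgn (z i)"] by simp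
    moreover have "length bs = Suc (length ?cs)" using i by simp
    moreover have "nat \<bar>z i\<bar> > 0" using i by simp
    ultimately show ?thesis unfolding P_def by blast
  qed
  then have "P (Least P)" by (rule LeastI)
  define d where "d = Least P"
  have "P d" using \<open>P (Least P)\<close> by (simp add: d_def)
  then obtain b0 cs y where d: "d > 0" and len: "length bs = Suc (length cs)"
    and b0: "int_span (b0 # cs) = int_span bs" and y: "y \<in> int_span cs"
    and dy: "of_nat d *\<^sub>R b0 + y \<in> M"
    unfolding P_def by blast
  have min: "c mod int d = 0"
    if "length bs = Suc (length as)" "int_span (a # as) = int_span bs" "w \<in> int_span as"
      "of_int (c mod int d) *\<^sub>R a + w \<in> M" for c a as w
  proof (rule ccontr)
    assume nz: "c mod int d \<noteq> 0"
    have lt: "0 \<le> c mod int d" "c mod int d < int d" using d by simp_all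
    have "P (nat (c mod int d))" unfolding P_def using that nz lt by auto
    then have "d \<le> nat (c mod int d)" unfolding d_def by (rule Least_le)
    then show False using lt by linarith
  qed
  obtain z where z: "y = (\<Sum>j<length cs. of_int (z j) *\<^sub>R cs ! j)"
    using y unfolding int_span_def by auto
  \<comment> \<open>The new pivot absorbs the multiples of \<open>d\<close> in the other coefficients, which leaves their
    remainders modulo \<open>d\<close>; each of them vanishes by minimality once it is moved to the front.\<close>
  define w where "w = (\<Sum>j<length cs. of_int (z j div int d) *\<^sub>R cs ! j)"
  define b where "b = b0 + w"
  have w: "w \<in> int_span cs"
    unfolding w_def int_span_def by (intro range_eqI[of _ _ "\<lambda>j. z j div int d"]) simp
  then have b: "int_span (b # cs) = int_span bs"
    unfolding b_def using b0 int_span_pivot_add by metis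
  have "y = of_nat d *\<^sub>R w + (\<Sum>j<length cs. of_int (z j mod int d) *\<^sub>R cs ! j)"
  proof -
    have "real_of_int (z j) = real d * of_int (z j div int d) + of_int (z j mod int d)" for j
      by (metis mult_div_mod_eq of_int_add of_int_mult of_int_of_nat_eq)
    then show ?thesis
      unfolding z w_def by (simp add: scaleR_left_distrib sum.distrib scaleR_sum_right)
  qed
  then have red: "of_nat d *\<^sub>R b0 + y
      = of_nat d *\<^sub>R b + (\<Sum>j<length cs. of_int (z j mod int d) *\<^sub>R cs ! j)"
    by (simp add: b_def scaleR_right_distrib)
  have "z i mod int d = 0" if i: "i < length cs" for i
  proof (rule min)
    let ?as = "cs[i := b]"
    let ?w = "of_nat d *\<^sub>R b + (\<Sum>j\<in>{..<length cs} - {i}. of_int (z j mod int d) *\<^sub>R cs ! j)"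
    show "length bs = Suc (length ?as)" using len by simp
    show "int_span (cs ! i # ?as) = int_span bs" using int_span_exchange[OF i] b by simp
    have "b \<in> int_span ?as" using int_span_base i by (metis set_update_memI subsetD)
    moreover have "cs ! j \<in> int_span ?as" if "j < length cs" "j \<noteq> i" for j
      using that int_span_base[of ?as]
      by (metis length_list_update nth_list_update_neq nth_mem subsetD)
    ultimately show "?w \<in> int_span ?as"
      by (intro int_submodule_add int_submodule_sum int_submodule_scale int_submodule_scale_nat
          int_span_submodule) auto
    show "of_int (z i mod int d) *\<^sub>R cs ! i + ?w \<in> M"
      using dy i unfolding red by (subst (asm) sum.remove[of _ i]) (auto simp: algebra_simps)
  qed
  then have db: "of_nat d *\<^sub>R b \<in> M" using dy unfolding red by simp
  show ?thesis
  proof (rule that[OF len b db])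
    fix c v assume v: "v \<in> int_span cs" and "of_int c *\<^sub>R b + v \<in> M"
    then have "of_int c *\<^sub>R b + v - of_int (c div int d) *\<^sub>R (of_nat d *\<^sub>R b) \<in> M"
      by (intro int_submodule_diff int_submodule_scale M db)
    moreover have "real_of_int c = of_int (c div int d) * real d + of_int (c mod int d)"
      by (metis div_mult_mod_eq of_int_add of_int_mult of_int_of_nat_eq)
    ultimately have "of_int (c mod int d) *\<^sub>R b + v \<in> M"
      by (simp add: scaleR_left_distrib algebra_simps)
    then show "int d dvd c" using min[OF len b v] by auto
  next
    fix e as i
    assume as: "int_span as = int_span cs" "length as = length cs"
      and i: "i < length as" and e: "of_nat e *\<^sub>R as ! i \<in> M"
    \<comment> \<open>The element \<open>d b + e a\<close> of \<open>M\<close>, where \<open>a\<close> is the \<open>i\<close>-th entry of \<open>as\<close>, equals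
      \<open>d (b + (e div d) a) + (e mod d) a\<close>; now \<open>a\<close> is taken as the pivot.\<close>
    let ?b = "b + of_nat (e div d) *\<^sub>R as ! i"
    have "of_nat d *\<^sub>R b + of_nat e *\<^sub>R as ! i \<in> M" by (intro int_submodule_add M db e)
    moreover have "real e = real d * real (e div d) + real (e mod d)"
      by (metis mult_div_mod_eq of_nat_add of_nat_mult)
    ultimately have *: "of_int (int e mod int d) *\<^sub>R as ! i + of_nat d *\<^sub>R ?b \<in> M"
      by (simp add: scaleR_left_distrib scaleR_right_distrib algebra_simps flip: zmod_int)
    have "int_span (b # as) = int_span bs"
      using b int_span_Cons_cong[OF as(1)] by simp
    then have "int_span (?b # as) = int_span bs"
      using i int_span_base[of as]
      by (subst int_span_pivot_add)
        (auto intro!: int_submodule_scale_nat int_span_submodule)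
    then have "int_span (as ! i # as[i := ?b]) = int_span bs"
      using int_span_exchange[OF i] by simp
    moreover have "of_nat d *\<^sub>R ?b \<in> int_span (as[i := ?b])"
      by (intro int_submodule_scale_nat int_span_submodule
          subsetD[OF int_span_base set_update_memI[OF i]])
    ultimately have "int e mod int d = 0"
      using * len as(2) by (intro min[of "as[i := ?b]" "as ! i"]) auto
    then show "d dvd e" by (simp add: mod_eq_0_iff_dvd)
  qed
qed

lemma int_span_scaled_zero: "int_span (scaled (replicate n 0) bs) = {0}"
proof -
  have "int_span (scaled (replicate n 0) bs) \<subseteq> {0}"
    by (rule int_span_least) (auto simp: int_submodule_def scaled_def in_set_conv_nth)
  then show ?thesis using int_submodule_0[OF int_span_submodule] by blast
qed

text \<open>
  At each step of the induction the minimal pivot splits off one generator of \<open>M\<close>, and the rest of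
  \<open>M\<close> lies in the span of the remaining generators. Once this rest is zero, all remaining factors
  are 0, and 0 may end a divisibility chain.
\<close>
lemma int_submodule_stacked_bases:
  assumes "int_submodule M" "M \<subseteq> int_span bs"
  shows "\<exists>cs ds. length cs = length bs \<and> length ds = length bs \<and> int_span cs = int_span bs \<and>
    sorted_wrt (dvd) ds \<and> M = int_span (scaled ds cs)"
  using assms
proof (induction "length bs" arbitrary: bs M)
  case 0
  then have "bs = []" by simp
  moreover have "M = {0}"
    using 0 \<open>bs = []\<close> int_submodule_0[of M] by (auto simp: int_span_def)
  ultimately show ?case by (intro exI[of _ "[]"]) (auto simp: scaled_def int_span_def)
next
  case (Suc n)
  show ?case
  proof (cases "M = {0}")
    case True
    then show ?thesis
      by (intro exI[of _ bs] exI[of _ "replicate (length bs) 0"])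
        (auto simp: int_span_scaled_zero sorted_wrt_iff_nth_less)
  next
    case False
    obtain d b cs where len: "length bs = Suc (length cs)"
      and b: "int_span (b # cs) = int_span bs" and db: "of_nat d *\<^sub>R b \<in> M"
      and dvd1: "\<And>c y. y \<in> int_span cs \<Longrightarrow> of_int c *\<^sub>R b + y \<in> M \<Longrightarrow> int d dvd c"
      and dvd2: "\<And>e as i. int_span as = int_span cs \<Longrightarrow> length as = length cs \<Longrightarrow>
        i < length as \<Longrightarrow> of_nat e *\<^sub>R as ! i \<in> M \<Longrightarrow> d dvd e"
      by (rule minimal_pivot[OF Suc.prems False], rule that, assumption+)
    have "int_submodule (M \<inter> int_span cs)"
      using Suc.prems(1) int_span_submodule[of cs] by (auto simp: int_submodule_def)
    moreover have "n = length cs" using Suc.hyps(2) len by simp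
    ultimately obtain as ds where as: "length as = length cs" "length ds = length cs"
      "int_span as = int_span cs" "sorted_wrt (dvd) ds"
      and M': "M \<inter> int_span cs = int_span (scaled ds as)"
      using Suc.hyps(1)[of cs "M \<inter> int_span cs"] by auto
    have "d dvd e" if "e \<in> set ds" for e
    proof -
      obtain i where i: "i < length ds" "e = ds ! i" using \<open>e \<in> set ds\<close> by (metis in_set_conv_nth)
      then have "of_nat e *\<^sub>R as ! i = scaled ds as ! i" "i < length (scaled ds as)"
        using as by auto
      then have "of_nat e *\<^sub>R as ! i \<in> int_span (scaled ds as)"
        using subsetD[OF int_span_base nth_mem] by metis
      then show ?thesis using dvd2[of as i e] as i M' by auto
    qed
    moreover have "M = int_span (scaled (d # ds) (b # as))"
    proof (rule antisym)
      show "int_span (scaled (d # ds) (b # as)) \<subseteq> M"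
        using db M' int_span_base[of "scaled ds as"] Suc.prems(1)
        by (intro int_span_least) auto
    next
      show "M \<subseteq> int_span (scaled (d # ds) (b # as))"
      proof
        fix x assume x: "x \<in> M"
        then have "x \<in> int_span (b # cs)" using Suc.prems(2) b by auto
        then obtain c y where y: "y \<in> int_span cs" and xy: "x = of_int c *\<^sub>R b + y"
          using int_span_Cons_iff[of x b cs] by blast
        then obtain q where q: "c = int d * q" using dvd1 x by blast
        have "y = x - of_int q *\<^sub>R (of_nat d *\<^sub>R b)" by (simp add: xy q mult.commute)
        then have "y \<in> M"
          using x db Suc.prems(1) by (metis int_submodule_diff int_submodule_scale)
        then have "y \<in> int_span (scaled ds as)" using y M' by blast
        moreover have "x = of_int q *\<^sub>R (of_nat d *\<^sub>R b) + y" by (simp add: xy q mult.commute)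
        ultimately show "x \<in> int_span (scaled (d # ds) (b # as))"
          unfolding scaled_Cons int_span_Cons_iff by blast
      qed
    qed
    moreover have "int_span (b # as) = int_span bs"
      using b int_span_Cons_cong[OF as(3)] by simp
    ultimately show ?thesis
      using as len by (intro exI[of _ "b # as"] exI[of _ "d # ds"]) auto
  qed
qed

section \<open>Stacked bases and their uniqueness\<close>

text \<open>
  The divisibility chain is expressed by \<^const>\<open>sorted_wrt\<close>, which compares all pairs of positions
  and not only adjacent ones.
\<close>
definition stacked_basis ::
  "'a::euclidean_space set \<Rightarrow> 'a set \<Rightarrow> 'a list \<Rightarrow> nat list \<Rightarrow> bool" where
  "stacked_basis L M bs ds \<longleftrightarrow> lattice_basis bs L \<and> length ds = length bs \<and>
     (\<forall>d\<in>set ds. 0 < d) \<and> sorted_wrt (dvd) ds \<and> M = int_span (scaled ds bs)"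

lemma sorted_dvd_nth:
  fixes ds :: "nat list"
  assumes "sorted_wrt (dvd) ds" "j \<le> k" "k < length ds"
  shows "ds ! j dvd ds ! k"
  using assms sorted_wrt_nth_less[OF assms(1), of j k] by (cases "j = k") auto

lemma stacked_basis_mem_iff:
  assumes "stacked_basis L M bs ds"
  shows "(\<Sum>i<length bs. of_int (z i) *\<^sub>R bs ! i) \<in> M \<longleftrightarrow> (\<forall>i<length bs. int (ds ! i) dvd z i)"
proof -
  have L: "lattice_basis bs L" and len: "length ds = length bs"
    and M: "M = int_span (scaled ds bs)"
    using assms by (auto simp: stacked_basis_def)
  have comb: "(\<Sum>i<length (scaled ds bs). of_int (u i) *\<^sub>R scaled ds bs ! i) =
      (\<Sum>i<length bs. of_int (int (ds ! i) * u i) *\<^sub>R bs ! i)" for u :: "nat \<Rightarrow> int"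
    using len by (intro sum.cong) (auto simp: mult.commute)
  show ?thesis
  proof
    assume "(\<Sum>i<length bs. of_int (z i) *\<^sub>R bs ! i) \<in> M"
    then obtain u where "(\<Sum>i<length bs. of_int (z i) *\<^sub>R bs ! i) =
        (\<Sum>i<length bs. of_int (int (ds ! i) * u i) *\<^sub>R bs ! i)"
      unfolding M int_span_def comb by auto
    from lattice_basis_coeffs_unique[OF L this]
    show "\<forall>i<length bs. int (ds ! i) dvd z i" by simp
  next
    assume "\<forall>i<length bs. int (ds ! i) dvd z i"
    then have "(\<Sum>i<length bs. of_int (z i) *\<^sub>R bs ! i) =
        (\<Sum>i<length bs. of_int (int (ds ! i) * (z i div int (ds ! i))) *\<^sub>R bs ! i)"
      by (intro sum.cong) auto
    then show "(\<Sum>i<length bs. of_int (z i) *\<^sub>R bs ! i) \<in> M"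
      unfolding M int_span_def comb by (rule range_eqI[of _ _ "\<lambda>i. z i div int (ds ! i)"])
  qed
qed

lemma stacked_basis_subset: "stacked_basis L M bs ds \<Longrightarrow> M \<subseteq> L"
  unfolding stacked_basis_def lattice_basis_def
  by (auto simp: int_span_subset_iff scaled_def set_zip
      intro!: int_submodule_scale_nat int_span_submodule int_span_nth)

lemma stacked_basisI:
  assumes "lattice_basis bs L" "length ds = length bs" "\<forall>d\<in>set ds. 0 < d" "sorted_wrt (dvd) ds"
    and "M \<subseteq> L"
    and mem: "\<And>z. (\<Sum>i<length bs. of_int (z i) *\<^sub>R bs ! i) \<in> M
      \<longleftrightarrow> (\<forall>i<length bs. int (ds ! i) dvd z i)"
  shows "stacked_basis L M bs ds"
proof -
  let ?M = "int_span (scaled ds bs)"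
  have s: "stacked_basis L ?M bs ds" using assms by (simp add: stacked_basis_def)
  have "x \<in> M \<longleftrightarrow> x \<in> ?M" if "x \<in> L" for x
    using that mem stacked_basis_mem_iff[OF s] lattice_basis_mem_iff[OF assms(1)] by auto
  then have "M = ?M" using assms(5) stacked_basis_subset[OF s] by blast
  then show ?thesis using s by simp
qed

lemma dim_scaled_full:
  assumes "length ds = length bs" "\<forall>d\<in>set ds. 0 < d"
  shows "dim (int_span (scaled ds bs)) = dim (int_span bs)"
proof -
  have "b \<in> span (set (scaled ds bs))" if "b \<in> set bs" for b
  proof -
    obtain i where i: "i < length bs" "b = bs ! i" using \<open>b \<in> set bs\<close> by (metis in_set_conv_nth)
    then have "of_nat (ds ! i) *\<^sub>R b \<in> set (scaled ds bs)"
      using nth_mem[of i "scaled ds bs"] assms(1) by simp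
    then have "(1 / real (ds ! i)) *\<^sub>R (of_nat (ds ! i) *\<^sub>R b) \<in> span (set (scaled ds bs))"
      by (intro span_scale span_base)
    moreover have "ds ! i > 0" using i assms by auto
    ultimately show ?thesis by simp
  qed
  moreover have "set (scaled ds bs) \<subseteq> span (set bs)"
    using assms(1) by (auto simp: scaled_def set_zip intro!: span_scale span_base[OF nth_mem])
  ultimately have "span (set (scaled ds bs)) = span (set bs)"
    by (intro antisym span_minimal) auto
  then show ?thesis by (metis dim_span span_int_span)
qed

lemma stacked_basis_scaled:
  "stacked_basis L M bs ds \<Longrightarrow> lattice_basis (scaled ds bs) M"
  unfolding stacked_basis_def lattice_basis_iff_dim by (auto simp: dim_scaled_full)

text \<open>
  If a factor were 0, then \<open>M\<close> would be spanned by fewer vectors than its dimension.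
\<close>
lemma stacked_basis_exists:
  assumes L: "is_lattice n L" and M: "int_submodule M" "M \<subseteq> L" "dim M = dim L"
  shows "\<exists>bs ds. stacked_basis L M bs ds"
proof -
  obtain bs where bs: "lattice_basis bs L" using L by (auto simp: is_lattice_def)
  then obtain cs ds where cs: "length cs = length bs" "length ds = length bs"
    "int_span cs = int_span bs" "sorted_wrt (dvd) ds" "M = int_span (scaled ds cs)"
    using int_submodule_stacked_bases[of M bs] M by (auto simp: lattice_basis_def)
  have basis: "lattice_basis cs L" using bs cs by (simp add: lattice_basis_iff_dim)
  have "0 < d" if "d \<in> set ds" for d
  proof (rule ccontr)
    assume "\<not> 0 < d"
    obtain i where i: "i < length ds" "d = ds ! i" using \<open>d \<in> set ds\<close> by (metis in_set_conv_nth)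
    let ?S = "set (scaled ds cs)"
    have "0 \<in> ?S"
      using nth_mem[of i "scaled ds cs"] i cs \<open>\<not> 0 < d\<close> by auto
    then have "card (?S - {0}) < card ?S" by (intro card_Diff1_less) auto
    also have "\<dots> \<le> length bs" using card_length[of "scaled ds cs"] cs by simp
    also have "\<dots> = dim M" using bs M(3) by (simp add: lattice_basis_iff_dim)
    also have "\<dots> \<le> card (?S - {0})"
    proof (rule dim_le_card)
      show "M \<subseteq> span (?S - {0})"
        using span_superset[of M] span_int_span[of "scaled ds cs"] cs(5) by simp
    qed simp
    finally show False by simp
  qed
  then have "stacked_basis L M cs ds"
    using cs basis by (simp add: stacked_basis_def)
  then show ?thesis by blast
qed

text \<open>
  The action of a matrix on a list of vectors, whose rows are the coefficients of the new vectors.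
  It turns changes of basis into products of integer matrices.
\<close>
definition int_rows :: "int mat \<Rightarrow> 'a::real_vector list \<Rightarrow> 'a list" where
  "int_rows A bs = map (\<lambda>i. \<Sum>j<length bs. of_int (A $$ (i, j)) *\<^sub>R bs ! j) [0..<dim_row A]"

lemma length_int_rows [simp]: "length (int_rows A bs) = dim_row A"
  by (simp add: int_rows_def)

lemma nth_int_rows [simp]:
  "i < dim_row A \<Longrightarrow> int_rows A bs ! i = (\<Sum>j<length bs. of_int (A $$ (i, j)) *\<^sub>R bs ! j)"
  by (simp add: int_rows_def)

lemma int_rows_mult:
  assumes "dim_row B = dim_col A" "dim_col B = length bs"
  shows "int_rows (A * B) bs = int_rows A (int_rows B bs)"
proof (rule nth_equalityI)
  fix i assume "i < length (int_rows (A * B) bs)"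
  then have i: "i < dim_row A" by simp
  have "(\<Sum>j<length bs. of_int ((A * B) $$ (i, j)) *\<^sub>R bs ! j) =
      (\<Sum>j<length bs. \<Sum>k<dim_row B. (of_int (A $$ (i, k)) * of_int (B $$ (k, j))) *\<^sub>R bs ! j)"
    using i assms
    by (intro sum.cong) (auto simp: scalar_prod_def scaleR_sum_left atLeast0LessThan)
  also have "\<dots> = (\<Sum>k<dim_row B. of_int (A $$ (i, k)) *\<^sub>R
      (\<Sum>j<length bs. of_int (B $$ (k, j)) *\<^sub>R bs ! j))"
    by (subst sum.swap) (simp add: scaleR_sum_right)
  finally show "int_rows (A * B) bs ! i = int_rows A (int_rows B bs) ! i"
    using i by simp
qed simp

lemma int_rows_diag:
  assumes "length ds = length bs"
  shows "int_rows (mat_diag (length bs) (\<lambda>i. int (ds ! i))) bs = scaled ds bs"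
proof (rule nth_equalityI)
  fix i assume "i < length (int_rows (mat_diag (length bs) (\<lambda>i. int (ds ! i))) bs)"
  then have i: "i < length bs" by (simp add: mat_diag_def)
  then show "int_rows (mat_diag (length bs) (\<lambda>i. int (ds ! i))) bs ! i = scaled ds bs ! i"
    using assms
    by (simp add: mat_diag_def, subst sum.remove[of _ i]) (auto intro!: sum.neutral)
qed (use assms in \<open>simp add: mat_diag_def\<close>)

lemma int_rows_one: "int_rows (1\<^sub>m (length bs)) bs = bs"
proof (rule nth_equalityI)
  fix i assume "i < length (int_rows (1\<^sub>m (length bs)) bs)"
  then have i: "i < length bs" by simp
  then show "int_rows (1\<^sub>m (length bs)) bs ! i = bs ! i"
    by (simp, subst sum.remove[of _ i]) (auto intro!: sum.neutral)
qed simp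

lemma int_span_int_rows_subset: "int_span (int_rows A bs) \<subseteq> int_span bs"
  unfolding int_span_subset_iff
  by (auto simp: int_rows_def
      intro!: int_submodule_sum int_submodule_scale int_span_submodule int_span_nth)

lemma lattice_basis_int_rows:
  assumes "lattice_basis bs L" "A \<in> carrier_mat (length bs) (length bs)"
    "B \<in> carrier_mat (length bs) (length bs)" "B * A = 1\<^sub>m (length bs)"
  shows "lattice_basis (int_rows A bs) L"
proof -
  have "int_rows B (int_rows A bs) = bs"
    using assms by (subst int_rows_mult[symmetric]) (auto simp: int_rows_one)
  then have "int_span bs \<subseteq> int_span (int_rows A bs)"
    using int_span_int_rows_subset[of B "int_rows A bs"] by simp
  then show ?thesis
    using assms int_span_int_rows_subset[of A bs] by (auto simp: lattice_basis_iff_dim)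
qed

lemma ex_int_rows:
  assumes "set cs \<subseteq> int_span bs"
  obtains A where "A \<in> carrier_mat (length cs) (length bs)" "cs = int_rows A bs"
proof -
  have "\<forall>i<length cs. \<exists>z. cs ! i = (\<Sum>j<length bs. of_int (z j) *\<^sub>R bs ! j)"
    using assms nth_mem unfolding int_span_def by blast
  then obtain z where z: "\<forall>i<length cs. cs ! i = (\<Sum>j<length bs. of_int (z i j) *\<^sub>R bs ! j)"
    by metis
  show ?thesis
    by (rule that[of "Matrix.mat (length cs) (length bs) (\<lambda>(i, j). z i j)"])
      (auto simp: z intro!: nth_equalityI)
qed

lemma invertible_matE:
  assumes "invertible_mat P" "P \<in> carrier_mat n n"
  obtains R where "R \<in> carrier_mat n n" "P * R = 1\<^sub>m n" "R * P = 1\<^sub>m n"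
proof -
  obtain R where R: "P * R = 1\<^sub>m (dim_row P)" "R * P = 1\<^sub>m (dim_row R)"
    using assms(1) by (auto simp: invertible_mat_def inverts_mat_def)
  have "dim_col R = n" using arg_cong[OF R(1), of dim_col] assms(2) by simp
  moreover have "dim_row R = n" using arg_cong[OF R(2), of dim_col] assms(2) by simp
  ultimately show ?thesis using that[of R] R assms(2) by auto
qed

text \<open>
  From \<open>P A Q = D\<close> one gets \<open>P A = D Q\<^sup>-\<^sup>1\<close>: the basis of \<open>M\<close> changed by \<open>P\<close> is the basis of \<open>L\<close>
  changed by the inverse of \<open>Q\<close>, with its vectors multiplied by the diagonal entries.
  Conversely, the coefficient matrix of a stacked basis is itself diagonal.
\<close>
lemma smith_normal_form_iff_stacked_basis:
  "(\<exists>A. coefficient_matrix L M A \<and> smith_normal_form A ds) \<longleftrightarrow> (\<exists>bs. stacked_basis L M bs ds)"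
proof
  assume "\<exists>A. coefficient_matrix L M A \<and> smith_normal_form A ds"
  then obtain A bs cs P Q where bs: "lattice_basis bs L" and cs: "lattice_basis cs M"
    and A: "A \<in> carrier_mat (length cs) (length bs)"
    and Acs: "\<forall>i<length cs. cs ! i = (\<Sum>j<length bs. of_int (A $$ (i, j)) *\<^sub>R bs ! j)"
    and pos: "\<forall>d\<in>set ds. 0 < d" and dvd: "\<forall>i. Suc i < length ds \<longrightarrow> ds ! i dvd ds ! Suc i"
    and A': "A \<in> carrier_mat (length ds) (length ds)"
    and P: "P \<in> carrier_mat (length ds) (length ds)" "invertible_mat P"
    and Q: "Q \<in> carrier_mat (length ds) (length ds)" "invertible_mat Q"
    and PAQ: "P * A * Q = mat_diag (length ds) (\<lambda>i. int (ds ! i))"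
    unfolding coefficient_matrix_def smith_normal_form_def by blast
  have len: "length cs = length ds" "length bs = length ds" using A A' by auto
  obtain P' where P': "P' \<in> carrier_mat (length ds) (length ds)" "P' * P = 1\<^sub>m (length ds)"
    using invertible_matE P by metis
  obtain Q' where Q': "Q' \<in> carrier_mat (length ds) (length ds)"
    "Q * Q' = 1\<^sub>m (length ds)" "Q' * Q = 1\<^sub>m (length ds)"
    using invertible_matE Q by metis
  have "cs = int_rows A bs" using Acs A by (auto intro!: nth_equalityI)
  have bs': "lattice_basis (int_rows Q' bs) L"
    using bs Q Q' len by (intro lattice_basis_int_rows[of _ _ _ Q]) auto
  have "P * A = mat_diag (length ds) (\<lambda>i. int (ds ! i)) * Q'"
  proof -
    have PA: "P * A \<in> carrier_mat (length ds) (length ds)" using P A' by simp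
    have "P * A * Q * Q' = P * A * (Q * Q')" by (rule assoc_mult_mat[OF PA Q(1) Q'(1)])
    then show ?thesis unfolding PAQ Q'(2) right_mult_one_mat[OF PA] by simp
  qed
  then have "int_rows P cs = int_rows (mat_diag (length ds) (\<lambda>i. int (ds ! i))) (int_rows Q' bs)"
    unfolding \<open>cs = int_rows A bs\<close>
    using P A' Q' len by (simp add: int_rows_mult[symmetric] mat_diag_def)
  also have "\<dots> = scaled ds (int_rows Q' bs)"
    using int_rows_diag[of ds "int_rows Q' bs"] Q' by simp
  finally have "lattice_basis (scaled ds (int_rows Q' bs)) M"
    using lattice_basis_int_rows[OF cs, of P P'] P P' len by simp
  moreover have "sorted_wrt (dvd) ds"
  proof -
    have "transp ((dvd) :: nat \<Rightarrow> nat \<Rightarrow> bool)" by (rule transpI) (rule dvd_trans)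
    then show ?thesis using dvd by (simp add: sorted_wrt_iff_nth_Suc_transp)
  qed
  ultimately show "\<exists>bs. stacked_basis L M bs ds"
    using bs' pos Q' by (intro exI[of _ "int_rows Q' bs"])
      (auto simp: stacked_basis_def lattice_basis_def)
next
  assume "\<exists>bs. stacked_basis L M bs ds"
  then obtain bs where s: "stacked_basis L M bs ds" by blast
  let ?D = "mat_diag (length ds) (\<lambda>i. int (ds ! i))"
  have len: "length ds = length bs" using s by (simp add: stacked_basis_def)
  have "coefficient_matrix L M ?D"
    unfolding coefficient_matrix_def
  proof (intro exI conjI allI impI)
    show "lattice_basis bs L" "lattice_basis (scaled ds bs) M"
      using s stacked_basis_scaled by (auto simp: stacked_basis_def)
    show "?D \<in> carrier_mat (length (scaled ds bs)) (length bs)" using len by simp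
    show "scaled ds bs ! i = (\<Sum>j<length bs. of_int (?D $$ (i, j)) *\<^sub>R bs ! j)"
      if "i < length (scaled ds bs)" for i
      using that int_rows_diag[OF len] nth_int_rows[of i ?D bs] len by (simp add: mat_diag_def)
  qed
  moreover have "smith_normal_form ?D ds"
    unfolding smith_normal_form_def
  proof (intro conjI bexI)
    show "\<forall>d\<in>set ds. 0 < d" using s by (simp add: stacked_basis_def)
    show "\<forall>i. Suc i < length ds \<longrightarrow> ds ! i dvd ds ! Suc i"
      using s by (auto simp: stacked_basis_def sorted_wrt_iff_nth_less)
    show "1\<^sub>m (length ds) * ?D * 1\<^sub>m (length ds) = ?D"
      by (simp add: right_mult_one_mat[of _ "length ds" "length ds"]
          left_mult_one_mat[of _ "length ds" "length ds"])
    show "invertible_mat (1\<^sub>m (length ds) :: int mat)" "invertible_mat (1\<^sub>m (length ds) :: int mat)"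
      by (auto simp: invertible_mat_def inverts_mat_def intro!: exI[of _ "1\<^sub>m (length ds)"])
  qed auto
  ultimately show "\<exists>A. coefficient_matrix L M A \<and> smith_normal_form A ds" by blast
qed

text \<open>
  Modulo \<open>h\<close>, the matrix has a zero block of \<open>i + 1\<close> rows and \<open>n - i\<close> columns. Since these numbers
  add up to more than \<open>n\<close>, no permutation avoids the block, by the pigeonhole principle, and every
  term of the Leibniz formula is divisible by \<open>h\<close>.
\<close>
lemma dvd_det_of_block:
  fixes A :: "'a::comm_ring_1 mat"
  assumes A: "A \<in> carrier_mat n n" and "i < n"
    and block: "\<And>j k. j \<le> i \<Longrightarrow> i \<le> k \<Longrightarrow> k < n \<Longrightarrow> h dvd A $$ (j, k)"
  shows "h dvd det A"
proof -
  have "h dvd (\<Prod>j = 0..<n. A $$ (j, \<pi> j))" if \<pi>: "\<pi> permutes {0..<n}" for \<pi>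
  proof -
    have "\<exists>j\<le>i. i \<le> \<pi> j"
    proof (rule ccontr)
      assume "\<not> ?thesis"
      then have "\<pi> ` {..i} \<subseteq> {..<i}" by auto
      then have "card (\<pi> ` {..i}) \<le> i" by (metis card_lessThan card_mono finite_lessThan)
      moreover have "card (\<pi> ` {..i}) = Suc i"
        using \<pi> by (subst card_image) (auto simp: permutes_inj_on)
      ultimately show False by simp
    qed
    then obtain j where j: "j \<le> i" "i \<le> \<pi> j" by blast
    then have "\<pi> j < n" using permutes_in_image[OF \<pi>, of j] \<open>i < n\<close> by simp
    then have "h dvd A $$ (j, \<pi> j)" using block j by simp
    then show ?thesis using j \<open>i < n\<close>
      by (elim dvd_trans) (auto intro!: dvd_prodI)
  qed
  then show ?thesis
    unfolding det_def'[OF A] by (auto intro!: dvd_sum dvd_mult)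
qed

text \<open>
  Let \<open>U\<close> express the first basis in the second one. The vectors \<open>d\<^sub>j b\<^sub>j\<close> lie in \<open>M\<close>, so \<open>d'\<^sub>k\<close>
  divides \<open>d\<^sub>j U\<^sub>j\<^sub>k\<close> for all \<open>j\<close> and \<open>k\<close>. For \<open>j \<le> i \<le> k\<close> the divisibility chains turn this into
  \<open>d'\<^sub>i\<close> dividing \<open>d\<^sub>i U\<^sub>j\<^sub>k\<close>, so that \<open>d'\<^sub>i\<close> divided by its greatest common divisor with \<open>d\<^sub>i\<close> divides a
  block of \<open>U\<close> too large for the unimodular matrix \<open>U\<close>, unless this quotient is 1.
\<close>
lemma stacked_basis_dvd:
  assumes s: "stacked_basis L M bs ds" and s': "stacked_basis L M bs' ds'" and i: "i < length bs"
  shows "ds' ! i dvd ds ! i"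
proof -
  let ?n = "length bs"
  have bs: "lattice_basis bs L" "length ds = ?n" "\<forall>d\<in>set ds. 0 < d" "sorted_wrt (dvd) ds"
    and bs': "lattice_basis bs' L" "length ds' = length bs'" "sorted_wrt (dvd) ds'"
    using s s' by (auto simp: stacked_basis_def)
  have n: "length bs' = ?n" using bs bs' by (simp add: lattice_basis_iff_dim)
  have sub: "set bs \<subseteq> int_span bs'" "set bs' \<subseteq> int_span bs"
    using bs bs' int_span_base unfolding lattice_basis_def by metis+
  obtain U where U: "U \<in> carrier_mat ?n ?n" "bs = int_rows U bs'"
    using ex_int_rows[OF sub(1)] n by metis
  obtain V where V: "V \<in> carrier_mat ?n ?n" "bs' = int_rows V bs"
    using ex_int_rows[OF sub(2)] n by metis
  have dims: "dim_row U = ?n" "dim_col U = ?n" "dim_row V = ?n" "dim_col V = ?n"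
    using U(1) V(1) by auto
  then have "int_rows (U * V) bs = int_rows U (int_rows V bs)"
    by (intro int_rows_mult) auto
  also have "\<dots> = int_rows (1\<^sub>m ?n) bs"
    unfolding int_rows_one V(2)[symmetric] U(2)[symmetric] ..
  finally have rows: "int_rows (U * V) bs = int_rows (1\<^sub>m ?n) bs" .
  have "U * V = 1\<^sub>m ?n"
  proof (intro eq_matI)
    fix j k assume jk: "j < dim_row (1\<^sub>m ?n)" "k < dim_col (1\<^sub>m ?n)"
    have "int_rows (U * V) bs ! j = int_rows (1\<^sub>m ?n) bs ! j"
      by (simp only: rows)
    then show "(U * V) $$ (j, k) = 1\<^sub>m ?n $$ (j, k)"
      using jk dims lattice_basis_coeffs_unique[OF bs(1),
          of "\<lambda>k. (U * V) $$ (j, k)" "\<lambda>k. 1\<^sub>m ?n $$ (j, k)" k]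
      by (simp del: index_mult_mat(1) index_one_mat(1))
  qed (use dims in auto)
  then have "det U * det V = 1" using det_mult[OF U(1) V(1)] by simp
  then have unit: "det U dvd 1" by (metis dvd_triv_left)
  define g where "g = gcd (ds' ! i) (ds ! i)"
  have "ds ! i > 0" using bs i by auto
  then have "g > 0" by (simp add: g_def)
  have "int (ds' ! i div g) dvd U $$ (j, k)" if j: "j \<le> i" and k: "i \<le> k" "k < ?n" for j k
  proof -
    have "ds ! j dvd ds ! i" "ds' ! i dvd ds' ! k"
      using sorted_dvd_nth[OF bs(4) j] sorted_dvd_nth[OF bs'(3) k(1)] k i bs bs' n by auto
    have "j < ?n" using j i by simp
    then have "scaled ds bs ! j \<in> M"
      using s bs subsetD[OF int_span_base nth_mem, of j "scaled ds bs"]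
      by (simp add: stacked_basis_def)
    moreover have "bs ! j = int_rows U bs' ! j" using U(2) by metis
    then have "scaled ds bs ! j = (\<Sum>k<length bs'. of_int (int (ds ! j) * U $$ (j, k)) *\<^sub>R bs' ! k)"
      using dims \<open>j < ?n\<close> bs(2) by (simp add: scaleR_sum_right)
    ultimately have "int (ds' ! k) dvd int (ds ! j) * U $$ (j, k)"
      using stacked_basis_mem_iff[OF s', of "\<lambda>k. int (ds ! j) * U $$ (j, k)"] k n by simp
    then have "int (ds' ! i) dvd int (ds ! i) * U $$ (j, k)"
      using \<open>ds ! j dvd ds ! i\<close> \<open>ds' ! i dvd ds' ! k\<close>
      by (meson dvd_trans int_dvd_int_iff mult_dvd_mono dvd_refl)
    then have "int (ds' ! i div g) * int g dvd int (ds ! i div g) * U $$ (j, k) * int g"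
      by (simp add: g_def ac_simps flip: of_nat_mult mult.assoc)
    then have "int (ds' ! i div g) dvd int (ds ! i div g) * U $$ (j, k)"
      using \<open>g > 0\<close> by simp
    moreover have "coprime (int (ds' ! i div g)) (int (ds ! i div g))"
      using \<open>ds ! i > 0\<close> unfolding g_def coprime_int_iff by (intro div_gcd_coprime) simp
    ultimately show ?thesis by (simp add: coprime_dvd_mult_right_iff)
  qed
  then have "int (ds' ! i div g) dvd det U"
    using U(1) i by (intro dvd_det_of_block)
  then have "int (ds' ! i div g) dvd 1" using unit dvd_trans by blast
  then have "ds' ! i = g" by (metis dvd_div_mult_self g_def gcd_dvd1 int_dvd_int_iff mult_1
        nat_dvd_1_iff_1 of_nat_1)
  then show ?thesis by (metis g_def gcd_dvd2)
qed

lemma stacked_basis_unique: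
  assumes "stacked_basis L M bs ds" "stacked_basis L M bs' ds'"
  shows "ds = ds'"
proof (rule nth_equalityI)
  have n: "length ds = length bs" "length ds' = length bs'" "length bs = length bs'"
    using assms by (auto simp: stacked_basis_def lattice_basis_iff_dim)
  then show "length ds = length ds'" by simp
  fix i assume "i < length ds"
  then show "ds ! i = ds' ! i"
    using stacked_basis_dvd[OF assms] stacked_basis_dvd[OF assms(2,1)] n
    by (simp add: dvd_antisym)
qed

lemma invariant_factors_eq:
  assumes "stacked_basis L M bs ds"
  shows "invariant_factors L M = ds"
  unfolding invariant_factors_def smith_normal_form_iff_stacked_basis
  using assms stacked_basis_unique by (intro the_equality) blast+

lemma sublattice_class_iff:
  assumes L: "is_lattice n L"
  shows "M \<in> sublattice_class L ds \<longleftrightarrow> (\<exists>bs. stacked_basis L M bs ds)"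
proof
  assume "M \<in> sublattice_class L ds"
  then obtain k where M: "M \<subseteq> L" "is_lattice k L" "is_lattice k M" and inv: "invariant_factors L M = ds"
    by (auto simp: sublattice_class_def sublattice_def)
  have "dim M = dim L" using M is_lattice_dim by metis
  moreover have "int_submodule M"
    using M(3) int_span_submodule by (auto simp: is_lattice_def lattice_basis_def)
  ultimately obtain bs ds' where s: "stacked_basis L M bs ds'"
    using stacked_basis_exists[OF L] M(1) by blast
  then show "\<exists>bs. stacked_basis L M bs ds" using invariant_factors_eq[OF s] inv by auto
next
  assume "\<exists>bs. stacked_basis L M bs ds"
  then obtain bs where s: "stacked_basis L M bs ds" by blast
  have "is_lattice (length bs) L"
    using s by (auto simp: is_lattice_def stacked_basis_def)
  moreover have "is_lattice (length bs) M"
    using s stacked_basis_scaled[OF s] unfolding is_lattice_def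
    by (intro exI[of _ "scaled ds bs"]) (simp add: stacked_basis_def)
  ultimately have "sublattice L M"
    using stacked_basis_subset[OF s] by (auto simp: sublattice_def)
  then show "M \<in> sublattice_class L ds"
    using invariant_factors_eq[OF s] by (simp add: sublattice_class_def)
qed

section \<open>Primary decomposition of sublattices\<close>

lemma gcd_mult_coprime_nat:
  fixes f a b :: nat
  assumes "coprime a b"
  shows "gcd f (a * b) = gcd f a * gcd f b"
proof (rule dvd_antisym)
  obtain a' b' where "gcd f (a * b) = a' * b'" "a' dvd a" "b' dvd b"
    using division_decomp[of "gcd f (a * b)" a b] by auto
  moreover from this have "a' dvd f" "b' dvd f"
    by (metis dvd_mult_left dvd_mult_right gcd_dvd1)+
  ultimately show "gcd f (a * b) dvd gcd f a * gcd f b" by (simp add: mult_dvd_mono)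
next
  have "coprime (gcd f a) (gcd f b)" using assms by (rule coprime_divisors[rotated 2]) auto
  then show "gcd f a * gcd f b dvd gcd f (a * b)"
    by (intro gcd_greatest divides_mult mult_dvd_mono) auto
qed

lemma ex_dvd_diff_mult_iff:
  fixes d q z :: int
  shows "(\<exists>w. d dvd z - q * w) \<longleftrightarrow> gcd d q dvd z"
proof
  assume "\<exists>w. d dvd z - q * w"
  then obtain w where "d dvd z - q * w" by blast
  then have "gcd d q dvd (z - q * w) + q * w" by (intro dvd_add) (auto intro: dvd_trans)
  then show "gcd d q dvd z" by simp
next
  assume "gcd d q dvd z"
  then obtain c where c: "z = gcd d q * c" by (rule dvdE)
  obtain u v where "u * d + v * q = gcd d q" using bezout_int by blast
  then have "z = d * (u * c) + q * (v * c)" unfolding c by (metis (no_types) distrib_left distrib_right mult.assoc mult.commute)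
  then have "z - q * (v * c) = d * (u * c)" by simp
  then show "\<exists>w. d dvd z - q * w" by (metis dvd_triv_left)
qed

lemma dvd_imp_prod_gcd_eq:
  fixes f :: nat
  assumes "finite I" "\<And>j k. j \<in> I \<Longrightarrow> k \<in> I \<Longrightarrow> j \<noteq> k \<Longrightarrow> coprime (q j) (q k)"
    and "f dvd (\<Prod>k\<in>I. q k)"
  shows "f = (\<Prod>k\<in>I. gcd f (q k))"
proof -
  have "gcd f (\<Prod>k\<in>I. q k) = (\<Prod>k\<in>I. gcd f (q k))"
    using assms(1,2)
  proof (induction I)
    case (insert j I)
    have "coprime (q j) (\<Prod>k\<in>I. q k)"
      using insert.hyps insert.prems by (intro prod_coprime_right) auto
    then have "gcd f (q j * (\<Prod>k\<in>I. q k)) = gcd f (q j) * gcd f (\<Prod>k\<in>I. q k)"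
      by (rule gcd_mult_coprime_nat)
    then show ?case using insert by simp
  qed simp
  then show ?thesis using assms(3) by (simp add: gcd_nat.absorb1)
qed

text \<open>
  The factors \<open>e j\<close> with \<open>j \<noteq> k\<close> are coprime to \<open>q k\<close> and do not contribute.
\<close>
lemma gcd_prod_eq:
  fixes e q :: "'i \<Rightarrow> nat"
  assumes "finite I" "\<And>j k. j \<in> I \<Longrightarrow> k \<in> I \<Longrightarrow> j \<noteq> k \<Longrightarrow> coprime (q j) (q k)"
    and "\<And>k. k \<in> I \<Longrightarrow> e k dvd q k" and "k \<in> I"
  shows "gcd (\<Prod>j\<in>I. e j) (q k) = e k"
proof -
  have "coprime (q k) (\<Prod>j\<in>I - {k}. e j)"
    using assms by (intro prod_coprime_right) (metis DiffD1 DiffD2 coprime_divisors dvd_refl insertI1)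
  then have "gcd (e k * (\<Prod>j\<in>I - {k}. e j)) (q k) = gcd (e k) (q k)"
    by (rule gcd_mult_left_right_cancel)
  also have "\<dots> = e k" using assms by (simp add: gcd_nat.absorb1)
  finally show ?thesis using assms by (simp add: prod.remove)
qed

lemma prod_dvd_iff_int:
  fixes e :: "'i \<Rightarrow> nat" and z :: int
  assumes "finite I" "\<And>j k. j \<in> I \<Longrightarrow> k \<in> I \<Longrightarrow> j \<noteq> k \<Longrightarrow> coprime (e j) (e k)"
  shows "int (\<Prod>k\<in>I. e k) dvd z \<longleftrightarrow> (\<forall>k\<in>I. int (e k) dvd z)"
  using assms
proof (induction I)
  case (insert j I)
  have "coprime (e j) (\<Prod>k\<in>I. e k)"
    using insert.hyps insert.prems by (intro prod_coprime_right) auto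
  then have "int (e j * (\<Prod>k\<in>I. e k)) dvd z \<longleftrightarrow> int (e j) dvd z \<and> int (\<Prod>k\<in>I. e k) dvd z"
    by (metis coprime_int_iff divides_mult dvd_mult_left dvd_mult_right of_nat_mult)
  then show ?case using insert by simp
qed simp

text \<open>The sublattice \<open>M + q L\<close>.\<close>
definition thicken :: "'a::euclidean_space set \<Rightarrow> nat \<Rightarrow> 'a set \<Rightarrow> 'a set" where
  "thicken L q M = {x + of_nat q *\<^sub>R y | x y. x \<in> M \<and> y \<in> L}"

text \<open>
  The coordinates of \<open>M + q L\<close> are those that become divisible by \<open>d\<^sub>i\<close> after subtraction of a
  multiple of \<open>q\<close>, and the subtraction can be chosen in each coordinate separately.
\<close>
lemma stacked_basis_thicken:
  assumes s: "stacked_basis L M bs ds" and "q > 0"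
  shows "stacked_basis L (thicken L q M) bs (map (\<lambda>d. gcd d q) ds)"
proof (rule stacked_basisI)
  have bs: "lattice_basis bs L" and len: "length ds = length bs" and sorted: "sorted_wrt (dvd) ds"
    using s by (auto simp: stacked_basis_def)
  have L: "int_submodule L" using bs int_span_submodule by (auto simp: lattice_basis_def)
  show "lattice_basis bs L" "length (map (\<lambda>d. gcd d q) ds) = length bs" by fact (simp add: len)
  show "\<forall>d\<in>set (map (\<lambda>d. gcd d q) ds). 0 < d" using \<open>q > 0\<close> by simp
  show "sorted_wrt (dvd) (map (\<lambda>d. gcd d q) ds)"
    unfolding sorted_wrt_map using sorted by (rule sorted_wrt_mono_rel[rotated]) auto
  show "thicken L q M \<subseteq> L"
    using stacked_basis_subset[OF s] unfolding thicken_def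
    by (auto intro!: int_submodule_add[OF L] int_submodule_scale_nat[OF L])
  fix z :: "nat \<Rightarrow> int"
  have "(\<Sum>i<length bs. of_int (z i) *\<^sub>R bs ! i) \<in> thicken L q M \<longleftrightarrow>
      (\<exists>w. (\<Sum>i<length bs. of_int (z i) *\<^sub>R bs ! i) -
        of_nat q *\<^sub>R (\<Sum>i<length bs. of_int (w i) *\<^sub>R bs ! i) \<in> M)"
    using lattice_basis_mem_iff[OF bs] unfolding thicken_def
    by (smt (verit, ccfv_threshold) add_diff_cancel_right' diff_add_cancel mem_Collect_eq)
  also have "\<dots> \<longleftrightarrow> (\<exists>w. (\<Sum>i<length bs. of_int (z i - int q * w i) *\<^sub>R bs ! i) \<in> M)"
    by (simp add: scaleR_left_diff_distrib sum_subtractf scaleR_sum_right)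
  also have "\<dots> \<longleftrightarrow> (\<exists>w. \<forall>i<length bs. int (ds ! i) dvd z i - int q * w i)"
    by (simp only: stacked_basis_mem_iff[OF s])
  also have "\<dots> \<longleftrightarrow> (\<forall>i<length bs. \<exists>w. int (ds ! i) dvd z i - int q * w)"
    by metis
  also have "\<dots> \<longleftrightarrow> (\<forall>i<length bs. gcd (int (ds ! i)) (int q) dvd z i)"
    by (simp only: ex_dvd_diff_mult_iff)
  also have "\<dots> \<longleftrightarrow> (\<forall>i<length bs. int (map (\<lambda>d. gcd d q) ds ! i) dvd z i)"
    using len by simp
  finally show "(\<Sum>i<length bs. of_int (z i) *\<^sub>R bs ! i) \<in> thicken L q M \<longleftrightarrow>
    (\<forall>i<length bs. int (map (\<lambda>d. gcd d q) ds ! i) dvd z i)" .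
qed

text \<open>
  The inverse map is the intersection of the components, taken inside \<open>L\<close> so that an empty index
  set yields \<open>L\<close>. In a stacked basis of \<open>M\<close> it returns \<open>M\<close> by divisibility by coprime numbers; the
  work lies in the invariant factors of the intersection of an arbitrary tuple.
\<close>
theorem primary_decomposition_bij:
  fixes L :: "'a::euclidean_space set" and q :: "'i \<Rightarrow> nat"
  assumes L: "is_lattice n L" and I: "finite I"
    and q: "\<And>k. k \<in> I \<Longrightarrow> q k > 0"
    and cop: "\<And>j k. j \<in> I \<Longrightarrow> k \<in> I \<Longrightarrow> j \<noteq> k \<Longrightarrow> coprime (q j) (q k)"
    and len: "\<And>k. k \<in> I \<Longrightarrow> length (es k) = n" "length ds = n"
    and sorted: "\<And>k. k \<in> I \<Longrightarrow> sorted_wrt (dvd) (es k)"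
    and dvd_q: "\<And>k i. k \<in> I \<Longrightarrow> i < n \<Longrightarrow> es k ! i dvd q k"
    and ds: "\<And>i. i < n \<Longrightarrow> ds ! i = (\<Prod>k\<in>I. es k ! i)"
  shows "bij_betw (\<lambda>M. \<lambda>k\<in>I. thicken L (q k) M) (sublattice_class L ds)
    (\<Pi>\<^sub>E k\<in>I. sublattice_class L (es k))"
proof (rule bij_betw_byWitness[where f' = "\<lambda>X. L \<inter> (\<Inter>k\<in>I. X k)"])
  let ?f = "\<lambda>M. \<lambda>k\<in>I. thicken L (q k) M" and ?g = "\<lambda>X. L \<inter> (\<Inter>k\<in>I. X k)"
  have n: "length bs = n" if "lattice_basis bs L" for bs
    using that is_lattice_dim[OF L] by (simp add: lattice_basis_iff_dim)
  have gcd_ds: "map (\<lambda>d. gcd d (q k)) ds = es k" if "k \<in> I" for k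
    using that I cop dvd_q len by (auto intro!: nth_equalityI gcd_prod_eq simp: ds)
  have thicken: "stacked_basis L (thicken L (q k) M) bs (es k)"
    if "stacked_basis L M bs ds" "k \<in> I" for M bs k
    using stacked_basis_thicken[OF that(1) q[OF that(2)]] gcd_ds[OF that(2)] by simp
  show "?f ` sublattice_class L ds \<subseteq> (\<Pi>\<^sub>E k\<in>I. sublattice_class L (es k))"
    using thicken unfolding sublattice_class_iff[OF L] by (fastforce simp: sublattice_class_iff[OF L])
  show "\<forall>M\<in>sublattice_class L ds. ?g (?f M) = M"
  proof
    fix M assume "M \<in> sublattice_class L ds"
    then obtain bs where s: "stacked_basis L M bs ds" by (auto simp: sublattice_class_iff[OF L])
    then have bs: "lattice_basis bs L" by (simp add: stacked_basis_def)
    have "x \<in> ?g (?f M) \<longleftrightarrow> x \<in> M" if "x \<in> L" for x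
    proof -
      obtain z where z: "x = (\<Sum>i<length bs. of_int (z i) *\<^sub>R bs ! i)"
        using lattice_basis_mem_iff[OF bs] \<open>x \<in> L\<close> by blast
      have "int (ds ! i) dvd z i \<longleftrightarrow> (\<forall>k\<in>I. int (es k ! i) dvd z i)" if "i < n" for i
        unfolding ds[OF that] using that cop dvd_q
        by (intro prod_dvd_iff_int I) (metis coprime_divisors)
      then show ?thesis
        using \<open>x \<in> L\<close> stacked_basis_mem_iff[OF s, of z] stacked_basis_mem_iff[OF thicken[OF s], of _ z]
        unfolding z n[OF bs] by auto
    qed
    then show "?g (?f M) = M" using stacked_basis_subset[OF s] by blast
  qed
  have main: "?g X \<in> sublattice_class L ds" "\<And>k. k \<in> I \<Longrightarrow> thicken L (q k) (?g X) = X k"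
    if X: "\<And>k. k \<in> I \<Longrightarrow> X k \<in> sublattice_class L (es k)" for X
  proof -
    have mod_L: "int_submodule L"
      using L int_span_submodule by (auto simp: is_lattice_def lattice_basis_def)
    have "\<exists>bs. stacked_basis L (X k) bs (es k)" if "k \<in> I" for k
      using X that by (simp add: sublattice_class_iff[OF L])
    then obtain bs where s: "\<And>k. k \<in> I \<Longrightarrow> stacked_basis L (X k) (bs k) (es k)" by metis
    have mod_X: "int_submodule (X k)" if "k \<in> I" for k
      using s[OF that] int_span_submodule by (auto simp: stacked_basis_def)
    have mod_g: "int_submodule (?g X)"
      using mod_L mod_X unfolding int_submodule_def by auto
    have X_sub: "X k \<subseteq> L" if "k \<in> I" for k using stacked_basis_subset s that by blast
    have mult_q: "of_nat (q k) *\<^sub>R x \<in> X k" if k: "k \<in> I" and "x \<in> L" for k x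
    proof -
      have bs: "lattice_basis (bs k) L" using s k by (simp add: stacked_basis_def)
      obtain z where z: "x = (\<Sum>i<length (bs k). of_int (z i) *\<^sub>R bs k ! i)"
        using lattice_basis_mem_iff[OF bs] \<open>x \<in> L\<close> by blast
      have "of_nat (q k) *\<^sub>R x = (\<Sum>i<length (bs k). of_int (int (q k) * z i) *\<^sub>R bs k ! i)"
        by (simp add: z scaleR_sum_right)
      then show ?thesis
        using stacked_basis_mem_iff[OF s[OF k], of "\<lambda>i. int (q k) * z i"] dvd_q[OF k] n[OF bs]
        by simp
    qed
    define Q where "Q = (\<Prod>k\<in>I. q k)"
    have "Q > 0" using q unfolding Q_def by (intro prod_pos) auto
    have mult_Q: "of_nat (\<Prod>k\<in>J. q k) *\<^sub>R x \<in> X k" if "x \<in> L" "J \<subseteq> I" "k \<in> J" for x J k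
    proof -
      have "finite J" using that I finite_subset by blast
      then have "(\<Prod>k\<in>J. q k) = (\<Prod>j\<in>J - {k}. q j) * q k"
        using that by (simp add: prod.remove mult.commute)
      then have "of_nat (\<Prod>k\<in>J. q k) *\<^sub>R x = of_nat (\<Prod>j\<in>J - {k}. q j) *\<^sub>R of_nat (q k) *\<^sub>R x"
        by simp
      then show ?thesis using that mult_q mod_X by (metis int_submodule_scale_nat subsetD)
    qed
    have Q_g: "of_nat Q *\<^sub>R x \<in> ?g X" if "x \<in> L" for x
      using mult_Q[OF that order_refl] int_submodule_scale_nat[OF mod_L that] unfolding Q_def by blast
    \<comment> \<open>If \<open>P\<close> is the product of the other moduli and \<open>u q + v P = 1\<close>, then \<open>x = v P x + q (u x)\<close>,
      where \<open>P x\<close> lies in every \<open>X j\<close>: for \<open>j = k\<close> since \<open>x\<close> does, otherwise since \<open>q j\<close> divides \<open>P\<close>.\<close>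
    show thick: "thicken L (q k) (?g X) = X k" if k: "k \<in> I" for k
    proof
      show "thicken L (q k) (?g X) \<subseteq> X k"
        using k mult_q unfolding thicken_def by (auto intro!: int_submodule_add[OF mod_X[OF k]])
    next
      show "X k \<subseteq> thicken L (q k) (?g X)"
      proof
        fix x assume x: "x \<in> X k"
        define P where "P = (\<Prod>j\<in>I - {k}. q j)"
        have "coprime (q k) P"
          unfolding P_def using k cop by (intro prod_coprime_right) auto
        then obtain u v where uv: "u * int (q k) + v * int P = 1"
          using bezout_int[of "int (q k)" "int P"] by (auto simp flip: coprime_iff_gcd_eq_1)
        have xL: "x \<in> L" using X_sub k x by blast
        have "of_nat P *\<^sub>R x \<in> X j" if "j \<in> I" for j
        proof (cases "j = k")
          case True
          then show ?thesis using x mod_X[OF k] by (simp add: int_submodule_scale_nat)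
        next
          case False
          then show ?thesis unfolding P_def using xL that by (intro mult_Q) auto
        qed
        then have "of_nat P *\<^sub>R x \<in> ?g X" using int_submodule_scale_nat[OF mod_L xL] by blast
        then have "of_int v *\<^sub>R of_nat P *\<^sub>R x \<in> ?g X" by (rule int_submodule_scale[OF mod_g])
        moreover have "x = of_int v *\<^sub>R of_nat P *\<^sub>R x + of_nat (q k) *\<^sub>R of_int u *\<^sub>R x"
        proof -
          have "of_int v * real P + real (q k) * of_int u = of_int (u * int (q k) + v * int P)"
            by (simp add: mult.commute)
          then show ?thesis unfolding uv by (simp flip: scaleR_left_distrib)
        qed
        ultimately show "x \<in> thicken L (q k) (?g X)"
          using int_submodule_scale[OF mod_L xL] unfolding thicken_def by blast
      qed
    qed
    have "dim (?g X) = dim L"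
    proof (rule antisym)
      show "dim (?g X) \<le> dim L" by (intro dim_subset) auto
      have "x \<in> span (?g X)" if "x \<in> L" for x
      proof -
        have "(1 / real Q) *\<^sub>R of_nat Q *\<^sub>R x \<in> span (?g X)"
          using Q_g[OF that] by (intro span_scale span_base)
        then show ?thesis using \<open>Q > 0\<close> by simp
      qed
      then show "dim L \<le> dim (?g X)" by (metis dim_span dim_subset subsetI)
    qed
    then obtain cs fs where t: "stacked_basis L (?g X) cs fs"
      using stacked_basis_exists[OF L mod_g] by blast
    then have cs: "lattice_basis cs L" and fs: "length fs = n"
      using n by (auto simp: stacked_basis_def)
    \<comment> \<open>Thickening a stacked basis of the intersection by \<open>q k\<close> gives one of \<open>X k\<close>, so uniqueness
      yields the greatest common divisors of the unknown factors with all \<open>q k\<close>. These determine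
      the factors, which divide the product of the \<open>q k\<close>.\<close>
    have "fs = ds"
    proof (rule nth_equalityI)
      show "length fs = length ds" using fs len by simp
      fix i assume "i < length fs"
      then have i: "i < n" using fs by simp
      have gcd_fs: "gcd (fs ! i) (q k) = es k ! i" if "k \<in> I" for k
      proof -
        have "stacked_basis L (X k) cs (map (\<lambda>d. gcd d (q k)) fs)"
          using stacked_basis_thicken[OF t q[OF that]] thick[OF that] by simp
        then have "map (\<lambda>d. gcd d (q k)) fs = es k" using s[OF that] by (rule stacked_basis_unique)
        then show ?thesis using nth_map[of i fs "\<lambda>d. gcd d (q k)"] fs i by simp
      qed
      have "fs ! i dvd Q"
      proof -
        have "cs ! i \<in> L" using cs i n[OF cs] int_span_nth by (metis lattice_basis_def)
        then have "of_nat Q *\<^sub>R cs ! i \<in> ?g X" by (rule Q_g)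
        moreover have "of_nat Q *\<^sub>R cs ! i =
            (\<Sum>j<length cs. of_int (if j = i then int Q else 0) *\<^sub>R cs ! j)"
          using i n[OF cs] by (subst sum.remove[of _ i]) (auto intro!: sum.neutral)
        ultimately have "int (fs ! i) dvd int Q"
          using stacked_basis_mem_iff[OF t, of "\<lambda>j. if j = i then int Q else 0"] i n[OF cs] by auto
        then show ?thesis by simp
      qed
      then have "fs ! i = (\<Prod>k\<in>I. gcd (fs ! i) (q k))"
        using cop unfolding Q_def by (intro dvd_imp_prod_gcd_eq I)
      also have "\<dots> = ds ! i" unfolding ds[OF i] using gcd_fs by (rule prod.cong[OF refl])
      finally show "fs ! i = ds ! i" .
    qed
    then show "?g X \<in> sublattice_class L ds" using t by (auto simp: sublattice_class_iff[OF L])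
  qed
  show "\<forall>X\<in>\<Pi>\<^sub>E k\<in>I. sublattice_class L (es k). ?f (?g X) = X"
  proof
    fix X assume X: "X \<in> (\<Pi>\<^sub>E k\<in>I. sublattice_class L (es k))"
    then have "X k \<in> sublattice_class L (es k)" if "k \<in> I" for k using that by auto
    then have *: "thicken L (q k) (?g X) = X k" if "k \<in> I" for k using main(2) that by blast
    show "?f (?g X) = X"
      by (rule extensionalityI[of _ I]) (use X * in \<open>auto simp: PiE_def\<close>)
  qed
  show "?g ` (\<Pi>\<^sub>E k\<in>I. sublattice_class L (es k)) \<subseteq> sublattice_class L ds"
  proof clarify
    fix X assume "X \<in> (\<Pi>\<^sub>E k\<in>I. sublattice_class L (es k))"
    then show "?g X \<in> sublattice_class L ds" by (intro main(1)) auto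
  qed
qed

section \<open>Elementary factors and the counting formula\<close>

text \<open>
  Since the primes are distinct, the one at position \<open>k\<close> divides the product exactly \<open>a k\<close> times;
  those with exponent 0 are not prime factors and leave no trace on the left.
\<close>
lemma prime_power_parts_prod:
  fixes p :: "nat \<Rightarrow> nat" and a :: "nat \<Rightarrow> nat"
  assumes p: "\<And>k. k < l \<Longrightarrow> prime (p k)" and inj: "inj_on p {..<l}"
  defines "d \<equiv> \<Prod>k<l. p k ^ a k"
  shows "{# q ^ multiplicity q d. q \<in># mset_set (prime_factors d) #} =
    (\<Sum>k<l. if 0 < a k then {# p k ^ a k #} else {#})"
proof -
  let ?K = "{k. k < l \<and> 0 < a k}"
  have p_neq_0: "p k \<noteq> 0" if "k < l" for k
    using p[OF that] by (metis not_prime_0)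
  have mult: "multiplicity (p k) d = a k" if k: "k < l" for k
  proof -
    have "multiplicity (p k) d = (\<Sum>j<l. multiplicity (p k) (p j ^ a j))"
      unfolding d_def using k
      by (intro prime_elem_multiplicity_prod_distrib) (auto simp: p_neq_0 p)
    also have "\<dots> = (\<Sum>j<l. if j = k then a k else 0)"
      using p k inj by (intro sum.cong refl) (auto simp: multiplicity_distinct_prime_power inj_on_eq_iff)
    finally show ?thesis using k by simp
  qed
  have "d \<noteq> 0" by (auto simp: d_def p_neq_0)
  have "prime_factors d = p ` ?K"
  proof (intro equalityI subsetI)
    fix q assume "q \<in> prime_factors d"
    then have q: "prime q" "q dvd d" by auto
    then obtain k where k: "k < l" "q dvd p k ^ a k"
      by (auto simp: d_def prime_dvd_prod_iff)
    then have "q dvd p k" "0 < a k" using q(1) prime_dvd_power by (auto intro!: gr0I)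
    then show "q \<in> p ` ?K" using k q(1) p primes_dvd_imp_eq by blast
  next
    fix q assume "q \<in> p ` ?K"
    then obtain k where "k < l" "0 < a k" "q = p k" by auto
    then show "q \<in> prime_factors d"
      using p mult[of k] by (auto simp: prime_factors_multiplicity)
  qed
  moreover have "inj_on p ?K" using inj by (rule inj_on_subset) auto
  ultimately have "mset_set (prime_factors d) = image_mset p (mset_set ?K)"
    by (simp add: image_mset_mset_set)
  then have "{# q ^ multiplicity q d. q \<in># mset_set (prime_factors d) #} =
      {# p k ^ a k. k \<in># mset_set ?K #}"
    using mult by (auto simp: multiset.map_comp intro!: image_mset_cong)
  also have "\<dots> = (\<Sum>k\<in>?K. {# p k ^ a k #})"
    by (simp add: sum_unfold_sum_mset)
  also have "\<dots> = (\<Sum>k<l. if 0 < a k then {# p k ^ a k #} else {#})"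
    by (intro sum.mono_neutral_cong_left) auto
  finally show ?thesis .
qed

lemma image_filter_mset_conv_sum:
  "{# f a. a \<in># filter_mset P (mset as) #} =
    (\<Sum>i<length as. if P (as ! i) then {# f (as ! i) #} else {#})"
proof (induction as rule: rev_induct)
  case (snoc a as)
  have "(\<Sum>i<length as. if P ((as @ [a]) ! i) then {# f ((as @ [a]) ! i) #} else {#}) =
      (\<Sum>i<length as. if P (as ! i) then {# f (as ! i) #} else {#})"
    by (intro sum.cong) (auto simp: nth_append)
  then show ?case using snoc by simp
qed simp

theorem corollary2p2:
  fixes \<Lambda> :: "'a::euclidean_space set"
    and n l m :: nat
    and p r :: "nat \<Rightarrow> nat"
    and \<alpha> :: "nat \<Rightarrow> nat list"
    and d :: "nat list"
  assumes "is_lattice n \<Lambda>"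
    and "\<And>k. k < l \<Longrightarrow> prime (p k)"
    and "inj_on p {..<l}"
    and "m = (\<Prod>k<l. p k ^ r k)"
    and "\<And>k. k < l \<Longrightarrow> \<alpha> k \<in> exponent_tuples n (r k)"
    and "length d = n"
    and "\<And>i. i < n \<Longrightarrow> d ! i = (\<Prod>k<l. p k ^ (\<alpha> k ! i))"
  shows "(\<exists>g. bij_betw g (sublattice_class \<Lambda> d) (\<Pi>\<^sub>E k\<in>{..<l}. primary_class \<Lambda> (p k) (\<alpha> k)))
    \<and> (\<forall>M\<in>sublattice_class \<Lambda> d. elementary_factors \<Lambda> M =
         (\<Sum>k<l. {# p k ^ a. a \<in># filter_mset (\<lambda>a. 0 < a) (mset (\<alpha> k)) #}))
    \<and> class_card \<Lambda> d = (\<Prod>k<l. primary_class_card \<Lambda> (p k) (\<alpha> k))"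
proof -
  note L = assms(1) and p = assms(2) and inj = assms(3) and d = assms(6,7)
  have \<alpha>: "length (\<alpha> k) = n" "sorted (\<alpha> k)" "\<And>i. i < n \<Longrightarrow> \<alpha> k ! i \<le> r k" if "k < l" for k
    using assms(5)[OF that] elem_le_sum_list[of _ "\<alpha> k"] by (auto simp: exponent_tuples_def)
  let ?g = "\<lambda>M. \<lambda>k\<in>{..<l}. thicken \<Lambda> (p k ^ r k) M"
  have bij: "bij_betw ?g (sublattice_class \<Lambda> d) (\<Pi>\<^sub>E k\<in>{..<l}. primary_class \<Lambda> (p k) (\<alpha> k))"
    unfolding primary_class_def
  proof (rule primary_decomposition_bij[OF L])
    show "coprime (p j ^ r j) (p k ^ r k)" if "j \<in> {..<l}" "k \<in> {..<l}" "j \<noteq> k" for j k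
    proof -
      have "p j \<noteq> p k" using inj that by (auto dest: inj_onD)
      then show ?thesis using p that by (simp add: primes_coprime)
    qed
    show "sorted_wrt (dvd) (map ((^) (p k)) (\<alpha> k))" if "k \<in> {..<l}" for k
      unfolding sorted_wrt_map
      using \<alpha>(2)[of k] that by (auto intro: sorted_wrt_mono_rel[of _ "(\<le>)"] le_imp_power_dvd)
    show "map ((^) (p k)) (\<alpha> k) ! i dvd p k ^ r k" if "k \<in> {..<l}" "i < n" for k i
      using \<alpha>[of k] that by (auto intro: le_imp_power_dvd)
    show "d ! i = (\<Prod>k<l. map ((^) (p k)) (\<alpha> k) ! i)" if "i < n" for i
      using d(2)[OF that] \<alpha>(1) that by simp
  qed (use p \<alpha> d in \<open>auto simp: prime_gt_0_nat\<close>)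
  have elem: "elementary_factors \<Lambda> M =
      (\<Sum>k<l. {# p k ^ a. a \<in># filter_mset (\<lambda>a. 0 < a) (mset (\<alpha> k)) #})"
    if "M \<in> sublattice_class \<Lambda> d" for M
  proof -
    have "invariant_factors \<Lambda> M = d" using that by (simp add: sublattice_class_def)
    then have "elementary_factors \<Lambda> M =
        (\<Sum>i<n. {# q ^ multiplicity q (d ! i). q \<in># mset_set (prime_factors (d ! i)) #})"
      unfolding elementary_factors_def
      by (simp add: sum_list_sum_nth d(1) atLeast0LessThan)
    also have "\<dots> = (\<Sum>i<n. \<Sum>k<l. if 0 < \<alpha> k ! i then {# p k ^ (\<alpha> k ! i) #} else {#})"
      by (intro sum.cong refl) (simp only: d(2) lessThan_iff prime_power_parts_prod[OF p inj])
    also have "\<dots> = (\<Sum>k<l. \<Sum>i<n. if 0 < \<alpha> k ! i then {# p k ^ (\<alpha> k ! i) #} else {#})"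
      by (rule sum.swap)
    also have "\<dots> = (\<Sum>k<l. {# p k ^ a. a \<in># filter_mset (\<lambda>a. 0 < a) (mset (\<alpha> k)) #})"
      using \<alpha>(1) by (intro sum.cong refl) (simp add: image_filter_mset_conv_sum)
    finally show ?thesis .
  qed
  have "class_card \<Lambda> d = card (\<Pi>\<^sub>E k\<in>{..<l}. primary_class \<Lambda> (p k) (\<alpha> k))"
    unfolding class_card_def by (rule bij_betw_same_card[OF bij])
  also have "\<dots> = (\<Prod>k<l. primary_class_card \<Lambda> (p k) (\<alpha> k))"
    by (simp add: card_PiE primary_class_card_def class_card_def primary_class_def)
  finally show ?thesis using bij elem by blast
qed

end
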